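(* Let $\mathcal E$ be a real Hilbert space, $\psi\in\Gamma_0(\mathcal E)$, $E\subset\mathcal E$ a nonempty closed convex set, $\beta>0$, and $\Xi\in\Gamma_0(\mathcal E)$ a $\beta$-strongly convex function. Consider the Extended Level-Set method described in the context (with $E^t=E^{t-1}\cup\{v^t\}$ at every iteration), and assume: (1) $\mathrm{dom}(\sigma_E)\cap\mathrm{dom}(\partial\Xi)\cap\mathrm{dom}(\psi)\neq\varnothing$; (2) for all $t\in\mathbb N$, $\partial\sigma_E(\mu^t)\ne\varnothing$, and there is a constant $C_{\mathrm{oracle}}$ such that $\|v^t\|\le C_{\mathrm{oracle}}$ for all $t\in\mathbb N$; (3) the set $E^{-1}$ is bounded and $\psi+\sigma_{E^{-1}}$ is coercive; (4) with $Q^{-1}=\{\mu\in\mathcal E:\psi(\mu)+\sigma_{E^{-1}}(\mu)\le\bar h^0\}$, we have $Q^{-1}\subset\mathrm{dom}(\Xi)$ and $\Xi$ is bounded over $Q^{-1}$; (5) for all $t\in\mathbb N$ there exists $w^{t+1}\in\partial\Xi(\mu^{t+1})$ such that $w^t-w^{t+1}\in N_{Q^t}(\mu^{t+1})$, and there is a constant $C_{\partial\Xi}>0$ such that $\|w^t\|\le C_{\partial\Xi}$ for all $t\in\mathbb N$; (6) there is a constant $C_\psi>0$ such that $|\psi(\mu^{t+1})-\psi(\mu^t)|\le C_\psi\|\mu^{t+1}-\mu^t\|$ for all $t\in\mathbb N$. Then the primal-dual gap $\Delta^t$ converges to $0$ with a speed of order $1/\sqrt t$: there exists $C>0$ such that,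 for all integers $t\ge1$, $$\Delta^t\le\frac{C}{\sqrt t}.$$
   Context: Notation. $\Gamma_0(\mathcal E)$ is the set of proper convex lower semicontinuous functions $\mathcal E\to\mathbb R\cup\{+\infty\}$; $\mathrm{dom}(g)$ is the set where $g$ is finite; $\partial g$ is the convex subdifferential and $\mathrm{dom}(\partial g)=\{\partial g\neq\varnothing\}$; $\sigma_S(\mu)=\sup_{x\in S}\langle\mu,x\rangle$; $N_S(\mu)$ is the normal cone of the convex set $S$ at $\mu$. $g$ is coercive if $g(x)\to+\infty$ as $\|x\|\to+\infty$. $\Xi$ is $\beta$-strongly convex if $\Xi-\frac\beta2\|\cdot\|^2$ is convex. For $\mu\in\mathcal E$, $\mu'\in\mathrm{dom}(\Xi)$, $w\in\mathcal E$, the Bregman distance is $B_\Xi(\mu,(\mu',w))=\Xi(\mu)-\Xi(\mu')-\langle\mu-\mu',w\rangle$ if $w\in\partial\Xi(\mu')$ and $+\infty$ otherwise. Extended Level-Set (ELS) method for the problem $\min_{\mu\in\mathcal E}\psi(\mu)+\sigma_E(\mu)$. Input: $\mu^0\in\mathrm{dom}(\sigma_E)\cap\mathrm{dom}(\partial\Xi)\cap\mathrm{dom}(\psi)$, $w^0\in\partial\Xi(\mu^0)$, $E^{-1}\subset E$, $\lambda\in(0,1)$. Set $\bar h^{-1}=+\infty$. For $t=0,1,2,\dots$: 1. Choose $v^t\in\partial\sigma_E(\mu^t)$. 2. Set $\bar h^t=\min\{\bar h^{t-1},\psi(\mu^t)+\sigma_E(\mu^t)\}$. 3. Set $\underline h^t=\inf_{\mu\in\mathcal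 E}\psi(\mu)+\sigma_{E^{t-1}\cup\{v^t\}}(\mu)$ and $E^t=E^{t-1}\cup\{v^t\}$. 4. Set $\Delta^t=\bar h^t-\underline h^t$, $\ell^t=\lambda\bar h^t+(1-\lambda)\underline h^t$, $Q^t=\{\mu:\psi(\mu)+\sigma_{E^t}(\mu)\le\ell^t\}$. 5. Let $\mu^{t+1}$ be the minimizer of $\mu\mapsto B_\Xi(\mu,(\mu^t,w^t))$ over $Q^t$, and take $w^{t+1}\in\partial\Xi(\mu^{t+1})$ with $w^t-w^{t+1}\in N_{Q^t}(\mu^{t+1})$. *)

theory Defs
  imports "HOL-Analysis.Analysis"
begin

(* Functions E -> R \<union> {+\<infinity>} are rendered as ereal-valued functions; "proper" excludes the value
   -\<infinity>.  In ereal, 0 * \<infinity> = 0 and \<infinity> + -\<infinity> = \<infinity>, so the inequality below is the usual one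
   (equivalently, convexity of the epigraph). *)

definition effective_domain :: "('a \<Rightarrow> ereal) \<Rightarrow> 'a set" where
  "effective_domain f = {x. \<bar>f x\<bar> \<noteq> \<infinity>}"

definition proper_function :: "('a \<Rightarrow> ereal) \<Rightarrow> bool" where
  "proper_function f \<longleftrightarrow> (\<forall>x. f x \<noteq> -\<infinity>) \<and> (\<exists>x. f x \<noteq> \<infinity>)"

definition convex_ereal :: "('a::real_vector \<Rightarrow> ereal) \<Rightarrow> bool" where
  "convex_ereal f \<longleftrightarrow>
     (\<forall>x y. \<forall>s\<in>{0..1::real}.
        f ((1 - s) *\<^sub>R x + s *\<^sub>R y) \<le> ereal (1 - s) * f x + ereal s * f y)"

definition lower_semicontinuous :: "('a::topological_space \<Rightarrow> ereal) \<Rightarrow> bool" where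
  "lower_semicontinuous f \<longleftrightarrow> (\<forall>x. f x \<le> Liminf (nhds x) f)"

definition Gamma0 :: "('a::real_inner \<Rightarrow> ereal) set" where
  "Gamma0 = {f. proper_function f \<and> convex_ereal f \<and> lower_semicontinuous f}"

definition strongly_convex :: "real \<Rightarrow> ('a::real_inner \<Rightarrow> ereal) \<Rightarrow> bool" where
  "strongly_convex \<beta> f \<longleftrightarrow> convex_ereal (\<lambda>x. f x - ereal (\<beta> / 2 * (norm x)\<^sup>2))"

(* For proper f this set is empty wherever f x = \<infinity>. *)
definition subdifferential :: "('a::real_inner \<Rightarrow> ereal) \<Rightarrow> 'a \<Rightarrow> 'a set" where
  "subdifferential f x = {w. \<forall>y. f x + ereal (w \<bullet> (y - x)) \<le> f y}"

definition subdifferential_domain :: "('a::real_inner \<Rightarrow> ereal) \<Rightarrow> 'a set" where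
  "subdifferential_domain f = {x. subdifferential f x \<noteq> {}}"

definition support_function :: "'a::real_inner set \<Rightarrow> 'a \<Rightarrow> ereal" where
  "support_function S \<mu> = (SUP x\<in>S. ereal (\<mu> \<bullet> x))"

definition normal_cone :: "'a::real_inner set \<Rightarrow> 'a \<Rightarrow> 'a set" where
  "normal_cone S \<mu> = (if \<mu> \<in> S then {z. \<forall>y\<in>S. z \<bullet> (y - \<mu>) \<le> 0} else {})"

definition coercive :: "('a::real_normed_vector \<Rightarrow> ereal) \<Rightarrow> bool" where
  "coercive f \<longleftrightarrow> (f \<longlongrightarrow> \<infinity>) at_infinity"

definition bregman :: "('a::real_inner \<Rightarrow> ereal) \<Rightarrow> 'a \<Rightarrow> 'a \<times> 'a \<Rightarrow> ereal" where
  "bregman \<Xi> \<mu> p = (case p of (\<mu>', w) \<Rightarrow>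
     if w \<in> subdifferential \<Xi> \<mu>' then \<Xi> \<mu> - \<Xi> \<mu>' - ereal ((\<mu> - \<mu>') \<bullet> w) else \<infinity>)"

definition els_objective :: "('a::real_inner \<Rightarrow> ereal) \<Rightarrow> 'a set \<Rightarrow> 'a \<Rightarrow> ereal" where
  "els_objective \<psi> S \<mu> = \<psi> \<mu> + support_function S \<mu>"

definition els_sublevel :: "('a::real_inner \<Rightarrow> ereal) \<Rightarrow> 'a set \<Rightarrow> ereal \<Rightarrow> 'a set" where
  "els_sublevel \<psi> S a = {\<mu>. els_objective \<psi> S \<mu> \<le> a}"

(* els_model Em v t is the set E^t, with Em playing the role of E^{-1}. *)
primrec els_model :: "'a set \<Rightarrow> (nat \<Rightarrow> 'a) \<Rightarrow> nat \<Rightarrow> 'a set" where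
  "els_model Em v 0 = Em \<union> {v 0}"
| "els_model Em v (Suc t) = els_model Em v t \<union> {v (Suc t)}"

primrec els_upper :: "('a::real_inner \<Rightarrow> ereal) \<Rightarrow> 'a set \<Rightarrow> (nat \<Rightarrow> 'a) \<Rightarrow> nat \<Rightarrow> ereal" where
  "els_upper \<psi> E \<mu> 0 = min \<infinity> (els_objective \<psi> E (\<mu> 0))"
| "els_upper \<psi> E \<mu> (Suc t) = min (els_upper \<psi> E \<mu> t) (els_objective \<psi> E (\<mu> (Suc t)))"

definition els_lower ::
    "('a::real_inner \<Rightarrow> ereal) \<Rightarrow> 'a set \<Rightarrow> (nat \<Rightarrow> 'a) \<Rightarrow> nat \<Rightarrow> ereal" where
  "els_lower \<psi> Em v t = (INF \<nu>. els_objective \<psi> (els_model Em v t) \<nu>)"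

definition els_gap ::
    "('a::real_inner \<Rightarrow> ereal) \<Rightarrow> 'a set \<Rightarrow> 'a set \<Rightarrow> (nat \<Rightarrow> 'a) \<Rightarrow> (nat \<Rightarrow> 'a) \<Rightarrow> nat \<Rightarrow> ereal" where
  "els_gap \<psi> E Em \<mu> v t = els_upper \<psi> E \<mu> t - els_lower \<psi> Em v t"

definition els_level ::
    "('a::real_inner \<Rightarrow> ereal) \<Rightarrow> 'a set \<Rightarrow> 'a set \<Rightarrow> real \<Rightarrow> (nat \<Rightarrow> 'a) \<Rightarrow> (nat \<Rightarrow> 'a) \<Rightarrow> nat \<Rightarrow> ereal" where
  "els_level \<psi> E Em lam \<mu> v t =
     ereal lam * els_upper \<psi> E \<mu> t + ereal (1 - lam) * els_lower \<psi> Em v t"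

definition els_level_set ::
    "('a::real_inner \<Rightarrow> ereal) \<Rightarrow> 'a set \<Rightarrow> 'a set \<Rightarrow> real \<Rightarrow> (nat \<Rightarrow> 'a) \<Rightarrow> (nat \<Rightarrow> 'a) \<Rightarrow> nat \<Rightarrow> 'a set" where
  "els_level_set \<psi> E Em lam \<mu> v t =
     els_sublevel \<psi> (els_model Em v t) (els_level \<psi> E Em lam \<mu> v t)"

(* (\<mu>, v, w) is a sequence of iterates, oracle answers and subgradients that the ELS method can
   produce from the input (\<mu> 0, w 0, Em, lam); all choices left open by the method are arbitrary. *)
definition els_run ::
    "('a::real_inner \<Rightarrow> ereal) \<Rightarrow> ('a \<Rightarrow> ereal) \<Rightarrow> 'a set \<Rightarrow> 'a set \<Rightarrow> real \<Rightarrow>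
     (nat \<Rightarrow> 'a) \<Rightarrow> (nat \<Rightarrow> 'a) \<Rightarrow> (nat \<Rightarrow> 'a) \<Rightarrow> bool" where
  "els_run \<psi> \<Xi> E Em lam \<mu> v w \<longleftrightarrow>
     \<mu> 0 \<in> effective_domain (support_function E) \<inter> subdifferential_domain \<Xi> \<inter> effective_domain \<psi> \<and>
     w 0 \<in> subdifferential \<Xi> (\<mu> 0) \<and>
     Em \<subseteq> E \<and>
     0 < lam \<and> lam < 1 \<and>
     (\<forall>t. v t \<in> subdifferential (support_function E) (\<mu> t)) \<and>
     (\<forall>t. is_arg_min (\<lambda>\<nu>. bregman \<Xi> \<nu> (\<mu> t, w t))
            (\<lambda>\<nu>. \<nu> \<in> els_level_set \<psi> E Em lam \<mu> v t) (\<mu> (Suc t))) \<and>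
     (\<forall>t. w (Suc t) \<in> subdifferential \<Xi> (\<mu> (Suc t)) \<and>
          w t - w (Suc t) \<in> normal_cone (els_level_set \<psi> E Em lam \<mu> v t) (\<mu> (Suc t)))"

end

theory Submission
  imports Defs
begin

text \<open>
  Moving from \<open>\<mu>\<^sup>t\<close> to the level set \<open>Q\<^sup>t\<close> must decrease \<open>\<psi> + \<langle>v\<^sup>t, \<cdot>\<rangle>\<close> by at least \<open>(1 - \<lambda>) \<Delta>\<^sup>t\<close>, and
  along the iterates this function is Lipschitz, so \<open>\<parallel>\<mu>\<^sup>t\<^sup>+\<^sup>1 - \<mu>\<^sup>t\<parallel>\<close> is at least a multiple of \<open>\<Delta>\<^sup>t\<close>.
  While the gap has not shrunk by the factor \<open>1 - \<lambda>\<close>, say for indices \<open>s \<le> t \<le> T\<close> with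
  \<open>(1 - \<lambda>) \<Delta>\<^sup>s < \<Delta>\<^sup>T\<close>, a near-minimizer of the model at \<open>T\<close> lies in all the level sets \<open>Q\<^sup>t\<close>; the
  Bregman distance from it to the iterates then drops by at least \<open>\<beta>/2 \<parallel>\<mu>\<^sup>t\<^sup>+\<^sup>1 - \<mu>\<^sup>t\<parallel>\<^sup>2\<close> at each step,
  so \<open>(T - s + 1) (\<Delta>\<^sup>T)\<^sup>2\<close> is bounded. Chaining such blocks gives a geometric series.
\<close>

lemma support_function_mono: "S \<subseteq> T \<Longrightarrow> support_function S x \<le> support_function T x"
  unfolding support_function_def by (rule SUP_subset_mono) auto

lemma support_function_upper: "s \<in> S \<Longrightarrow> ereal (x \<bullet> s) \<le> support_function S x"
  unfolding support_function_def by (rule SUP_upper)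

lemma support_function_not_MInf: "S \<noteq> {} \<Longrightarrow> support_function S x \<noteq> -\<infinity>"
  using support_function_upper[of _ S x] by force

lemma support_function_0: "S \<noteq> {} \<Longrightarrow> support_function S 0 = 0"
  unfolding support_function_def by (simp add: zero_ereal_def)

lemma support_function_add: "support_function S (x + y) \<le> support_function S x + support_function S y"
  unfolding support_function_def[of S "x + y"]
proof (rule SUP_least)
  fix s assume "s \<in> S"
  then have "ereal (x \<bullet> s) + ereal (y \<bullet> s) \<le> support_function S x + support_function S y"
    by (intro add_mono support_function_upper)
  then show "ereal ((x + y) \<bullet> s) \<le> support_function S x + support_function S y"
    by (simp add: inner_add_left)
qed

text \<open>Testing the subgradient inequality at \<open>0\<close> shows that the support function
  is finite at \<open>x\<close> and at most \<open>v \<bullet> x\<close> there. Testing it at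
  \<open>x + z\<close> and using subadditivity gives the linear minorant, and \<open>z = x\<close>
  yields the remaining inequality.\<close>

lemma subgradient_support_function:
  assumes "S \<noteq> {}" and v: "v \<in> subdifferential (support_function S) x"
  shows "support_function S x = ereal (v \<bullet> x)"
    and "ereal (v \<bullet> z) \<le> support_function S z"
proof -
  have sub: "support_function S x + ereal (v \<bullet> (y - x)) \<le> support_function S y" for y
    using v by (simp add: subdifferential_def)
  have "support_function S x + ereal (v \<bullet> (0 - x)) \<le> 0"
    using sub[of 0] support_function_0[OF assms(1)] by simp
  then obtain r where r: "support_function S x = ereal r" and "r \<le> v \<bullet> x"
    using support_function_not_MInf[OF assms(1), of x]
    by (cases "support_function S x") (auto simp: zero_ereal_def)
  have le: "ereal (v \<bullet> z) \<le> support_function S z" for z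
  proof -
    have "ereal r + ereal (v \<bullet> z) \<le> ereal r + support_function S z"
      using order_trans[OF sub[of "x + z"] support_function_add] r by simp
    then show ?thesis
      by (cases "support_function S z") auto
  qed
  show "ereal (v \<bullet> z) \<le> support_function S z" by (rule le)
  show "support_function S x = ereal (v \<bullet> x)"
    using r \<open>r \<le> v \<bullet> x\<close> le[of x] by simp
qed

lemma els_model_eq: "els_model Em v t = Em \<union> v ` {..t}"
  by (induction t) (auto simp: atMost_Suc)

text \<open>Points of \<open>Em\<close> lie in \<open>E\<close>, and each cut \<open>v s\<close> is
  a linear minorant of the support function by its subgradient property. Hence the models minorize
  the true objective.\<close>

lemma support_function_els_model_le:
  assumes "E \<noteq> {}" "Em \<subseteq> E" "\<And>t. v t \<in> subdifferential (support_function E) (\<mu> t)"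
  shows "support_function (els_model Em v t) x \<le> support_function E x"
  unfolding support_function_def[of "els_model Em v t"]
proof (rule SUP_least)
  fix y assume "y \<in> els_model Em v t"
  then consider "y \<in> E" | s where "y = v s"
    using assms(2) by (auto simp: els_model_eq)
  then show "ereal (x \<bullet> y) \<le> support_function E x"
    using subgradient_support_function(2)[OF assms(1) assms(3)]
    by cases (auto simp: support_function_upper inner_commute)
qed

lemma els_objective_mono_set: "S \<subseteq> T \<Longrightarrow> els_objective \<psi> S x \<le> els_objective \<psi> T x"
  unfolding els_objective_def by (intro add_left_mono support_function_mono)

text \<open>At a point \<open>z\<close> of the segment from \<open>y\<close> to \<open>x\<close>,
  the strong convexity inequality bounds \<open>f z\<close> from above and the subgradient
  inequality bounds it from below. Dividing by \<open>s\<close> leaves the claim with an extra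
  factor \<open>1 - s\<close>, which disappears as \<open>s\<close> tends to 0.\<close>

lemma strongly_convex_subgradient:
  fixes f :: "'a::real_inner \<Rightarrow> ereal"
  assumes "strongly_convex \<beta> f" "w \<in> subdifferential f y"
    and fx: "f x = ereal a" and fy: "f y = ereal b"
  shows "a - b - w \<bullet> (x - y) \<ge> \<beta> / 2 * (norm (x - y))\<^sup>2"
proof -
  have step: "a - b - w \<bullet> (x - y) \<ge> \<beta> / 2 * (1 - s) * (norm (x - y))\<^sup>2" if s: "0 < s" "s < 1" for s
  proof -
    define z where "z = (1 - s) *\<^sub>R y + s *\<^sub>R x"
    have "f z - ereal (\<beta> / 2 * (norm z)\<^sup>2) \<le>
        ereal (1 - s) * (f y - ereal (\<beta> / 2 * (norm y)\<^sup>2)) + ereal s * (f x - ereal (\<beta> / 2 * (norm x)\<^sup>2))"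
      using assms(1) s unfolding strongly_convex_def convex_ereal_def z_def by auto
    moreover have "f y + ereal (w \<bullet> (z - y)) \<le> f z"
      using assms(2) by (simp add: subdifferential_def)
    ultimately have
      "b + w \<bullet> (z - y) - \<beta> / 2 * (norm z)\<^sup>2 \<le>
        (1 - s) * (b - \<beta> / 2 * (norm y)\<^sup>2) + s * (a - \<beta> / 2 * (norm x)\<^sup>2)"
      using fx fy by (cases "f z") auto
    moreover have "w \<bullet> (z - y) = s * (w \<bullet> (x - y))"
      unfolding z_def by (simp add: algebra_simps inner_diff_right inner_add_right)
    moreover have "\<beta> / 2 * (norm z)\<^sup>2 =
        (1 - s) * (\<beta> / 2 * (norm y)\<^sup>2) + s * (\<beta> / 2 * (norm x)\<^sup>2)
          - s * (\<beta> / 2 * (1 - s) * (norm (x - y))\<^sup>2)"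
      unfolding z_def power2_norm_eq_inner
      by (simp add: inner_add_left inner_add_right inner_diff_left inner_diff_right inner_commute
          field_simps)
    ultimately have "s * (a - b - w \<bullet> (x - y)) \<ge> s * (\<beta> / 2 * (1 - s) * (norm (x - y))\<^sup>2)"
      unfolding right_diff_distrib left_diff_distrib by linarith
    then show ?thesis using s by simp
  qed
  have "((\<lambda>s. \<beta> / 2 * (1 - s) * (norm (x - y))\<^sup>2) \<longlongrightarrow> \<beta> / 2 * (1 - 0) * (norm (x - y))\<^sup>2) (at_right 0)"
    by (intro tendsto_intros)
  moreover have "\<forall>\<^sub>F s::real in at_right 0. 0 < s \<and> s < 1"
    unfolding eventually_at_right[OF zero_less_one] by (auto intro: exI[of _ 1])
  then have "\<forall>\<^sub>F s in at_right 0. \<beta> / 2 * (1 - s) * (norm (x - y))\<^sup>2 \<le> a - b - w \<bullet> (x - y)"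
    by (rule eventually_mono) (blast intro: step)
  ultimately have "\<beta> / 2 * (1 - 0) * (norm (x - y))\<^sup>2 \<le> a - b - w \<bullet> (x - y)"
    by (rule tendsto_upperbound) simp
  then show ?thesis by simp
qed

lemma coercive_sublevel_bounded:
  assumes "coercive f"
  shows "bounded {x. f x \<le> ereal c}"
proof -
  have "\<forall>\<^sub>F x in at_infinity. ereal c < f x"
    using assms unfolding coercive_def by (rule order_tendstoD) simp
  then obtain b where "\<And>x. b \<le> norm x \<Longrightarrow> ereal c < f x"
    by (auto simp: eventually_at_infinity)
  then have "norm x \<le> b" if "f x \<le> ereal c" for x
    using that by (meson linear not_le)
  then show ?thesis unfolding bounded_iff by blast
qed

text \<open>Strong induction on \<open>T\<close>. The block from the least \<open>s\<close> with
  \<open>q * \<Delta> s < \<Delta> T\<close> up to \<open>T\<close> costs at most \<open>K\<close>.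
  The \<open>s\<close> indices before it cost at most \<open>q^2\<close> times the inductive bound
  at \<open>s - 1\<close>. The value \<open>K / (1 - q^2)\<close> is the fixed point of
  \<open>a = K + q^2 * a\<close>.\<close>

lemma gap_square_bound:
  fixes \<Delta> :: "nat \<Rightarrow> real"
  assumes q: "0 < q" "q < 1" and nonneg: "\<And>t. 0 \<le> \<Delta> t" and "0 \<le> K"
    and block: "\<And>s T. s \<le> T \<Longrightarrow> q * \<Delta> s < \<Delta> T \<Longrightarrow> real (Suc T - s) * (\<Delta> T)\<^sup>2 \<le> K"
  shows "real (Suc T) * (\<Delta> T)\<^sup>2 \<le> K / (1 - q\<^sup>2)"
proof (induction T rule: less_induct)
  case (less T)
  have q2: "q\<^sup>2 < 1" using q by (simp add: power_less_one_iff)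
  show ?case
  proof (cases "\<Delta> T = 0")
    case True
    then show ?thesis using \<open>0 \<le> K\<close> q2 by simp
  next
    \<comment> \<open>A positive gap makes \<open>T\<close> itself a candidate for \<open>s\<close>,
      so the least index exists.\<close>
    case False
    then have pos: "q * \<Delta> T < \<Delta> T" using nonneg[of T] q by simp
    define s where "s = (LEAST s. q * \<Delta> s < \<Delta> T)"
    have s: "q * \<Delta> s < \<Delta> T" and sT: "s \<le> T"
      unfolding s_def by (rule LeastI[of "\<lambda>s. q * \<Delta> s < \<Delta> T", OF pos])
        (rule Least_le[of "\<lambda>s. q * \<Delta> s < \<Delta> T", OF pos])
    have last: "real (Suc T - s) * (\<Delta> T)\<^sup>2 \<le> K" using block[OF sT s] .
    have before: "real s * (\<Delta> T)\<^sup>2 \<le> q\<^sup>2 * (K / (1 - q\<^sup>2))"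
    proof (cases s)
      case 0
      then show ?thesis using \<open>0 \<le> K\<close> q2 by simp
    next
      case (Suc r)
      \<comment> \<open>Minimality of \<open>s\<close> fails the strict inequality at
        \<open>r = s - 1\<close>; squaring produces the factor \<open>q^2\<close>.\<close>
      then have "\<Delta> T \<le> q * \<Delta> r"
        using not_less_Least[of r "\<lambda>s. q * \<Delta> s < \<Delta> T"] unfolding s_def[symmetric] by simp
      then have "(\<Delta> T)\<^sup>2 \<le> (q * \<Delta> r)\<^sup>2" using nonneg by (intro power_mono)
      then have "real s * (\<Delta> T)\<^sup>2 \<le> q\<^sup>2 * (real (Suc r) * (\<Delta> r)\<^sup>2)"
        using Suc by (simp add: power_mult_distrib mult_left_mono mult.left_commute)
      also have "\<dots> \<le> q\<^sup>2 * (K / (1 - q\<^sup>2))"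
        using less[of r] Suc sT by (intro mult_left_mono) auto
      finally show ?thesis .
    qed
    have "real (Suc T) * (\<Delta> T)\<^sup>2 = real (Suc T - s) * (\<Delta> T)\<^sup>2 + real s * (\<Delta> T)\<^sup>2"
      using sT by (simp add: of_nat_diff algebra_simps)
    also have "\<dots> \<le> K + q\<^sup>2 * (K / (1 - q\<^sup>2))" using last before by simp
    also have "\<dots> = K / (1 - q\<^sup>2)" using q2 by (simp add: field_simps)
    finally show ?thesis .
  qed
qed

theorem theorem3p5:
  fixes \<psi> \<Xi> :: "'a::{real_inner, complete_space} \<Rightarrow> ereal"
    and E Em :: "'a set"
    and \<beta> lam :: real
    and \<mu> v w :: "nat \<Rightarrow> 'a"
  assumes psi: "\<psi> \<in> Gamma0"
    and E: "E \<noteq> {}" "closed E" "convex E"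
    and beta: "\<beta> > 0"
    and Xi: "\<Xi> \<in> Gamma0" "strongly_convex \<beta> \<Xi>"
    and run: "els_run \<psi> \<Xi> E Em lam \<mu> v w"
    and A1: "effective_domain (support_function E) \<inter> subdifferential_domain \<Xi>
               \<inter> effective_domain \<psi> \<noteq> {}"
    and A2: "\<forall>t. subdifferential (support_function E) (\<mu> t) \<noteq> {}"
            "\<exists>C_oracle. \<forall>t. norm (v t) \<le> C_oracle"
    and A3: "bounded Em" "coercive (els_objective \<psi> Em)"
    and A4: "els_sublevel \<psi> Em (els_upper \<psi> E \<mu> 0) \<subseteq> effective_domain \<Xi>"
            "\<exists>M::real. \<forall>\<nu>\<in>els_sublevel \<psi> Em (els_upper \<psi> E \<mu> 0). \<bar>\<Xi> \<nu>\<bar> \<le> ereal M"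
    and A5: "\<forall>t. \<exists>w'\<in>subdifferential \<Xi> (\<mu> (Suc t)).
               w t - w' \<in> normal_cone (els_level_set \<psi> E Em lam \<mu> v t) (\<mu> (Suc t))"
            "\<exists>C_Xi>0. \<forall>t. norm (w t) \<le> C_Xi"
    and A6: "\<exists>C_psi>0. \<forall>t. \<bar>\<psi> (\<mu> (Suc t)) - \<psi> (\<mu> t)\<bar> \<le> ereal (C_psi * norm (\<mu> (Suc t) - \<mu> t))"
  shows "(els_gap \<psi> E Em \<mu> v \<longlonglongrightarrow> 0) \<and>
         (\<exists>C>0. \<forall>t\<ge>1. els_gap \<psi> E Em \<mu> v t \<le> ereal (C / sqrt (real t)))"
proof -

  \<comment> \<open>Facts about the run and comparison of the models with the objective\<close>
  let ?f = "els_objective \<psi> E" and ?m = "\<lambda>t. els_objective \<psi> (els_model Em v t)"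
  let ?U = "els_upper \<psi> E \<mu>" and ?L = "els_lower \<psi> Em v"
  let ?Q = "els_level_set \<psi> E Em lam \<mu> v" and ?l = "els_level \<psi> E Em lam \<mu> v"
  let ?S = "els_sublevel \<psi> Em (?U 0)"
  \<comment> \<open>The level is \<open>hb t - q * \<Delta> t\<close>, and the same \<open>q\<close>
    is the contraction factor that separates blocks.\<close>
  define q where "q = 1 - lam"
  have q: "0 < q" "q < 1" using run unfolding els_run_def q_def by auto
  have EmE: "Em \<subseteq> E" using run unfolding els_run_def by auto
  have v: "v t \<in> subdifferential (support_function E) (\<mu> t)" for t
    using run unfolding els_run_def by auto
  have muQ: "\<mu> (Suc t) \<in> ?Q t" for t
    using run unfolding els_run_def is_arg_min_def by auto
  have w: "w t \<in> subdifferential \<Xi> (\<mu> t)" for t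
    using run unfolding els_run_def by (cases t) auto
  have wN: "(w t - w (Suc t)) \<bullet> (x - \<mu> (Suc t)) \<le> 0" if "x \<in> ?Q t" for t x
  proof -
    have "w t - w (Suc t) \<in> normal_cone (?Q t) (\<mu> (Suc t))"
      using run unfolding els_run_def by blast
    then show ?thesis using that muQ[of t] by (simp add: normal_cone_def)
  qed
  have sig: "support_function E (\<mu> t) = ereal (v t \<bullet> \<mu> t)" for t
    by (rule subgradient_support_function(1)[OF E(1) v])
  have psi_MInf: "\<psi> x \<noteq> -\<infinity>" for x
    using psi unfolding Gamma0_def proper_function_def by auto
  have m_le_f: "?m t x \<le> ?f x" for t x
    unfolding els_objective_def
    by (intro add_left_mono support_function_els_model_le[OF E(1) EmE v])
  have m_mono: "?m s x \<le> ?m t x" if "s \<le> t" for s t x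
    using that by (intro els_objective_mono_set) (auto simp: els_model_eq)
  have m0_le: "els_objective \<psi> Em x \<le> ?m t x" for t x
    by (intro els_objective_mono_set) (auto simp: els_model_eq)
  have m_lower: "\<psi> x + ereal (v t \<bullet> x) \<le> ?m t x" for t x
    unfolding els_objective_def inner_commute[of "v t"]
    by (intro add_left_mono support_function_upper) (auto simp: els_model_eq)

  \<comment> \<open>Finiteness and monotonicity of the upper and lower bounds\<close>
  have psi_fin: "\<bar>\<psi> (\<mu> t)\<bar> \<noteq> \<infinity>" for t
  proof (induction t)
    case 0
    then show ?case using run unfolding els_run_def effective_domain_def by auto
  next
    case (Suc t)
    \<comment> \<open>An infinite value at the next iterate would make the difference infinite,
      against the finite right-hand side.\<close>
    obtain C where "\<bar>\<psi> (\<mu> (Suc t)) - \<psi> (\<mu> t)\<bar> \<le> ereal (C * norm (\<mu> (Suc t) - \<mu> t))"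
      using A6 by blast
    then show ?case using Suc
      by (cases "\<psi> (\<mu> (Suc t))"; cases "\<psi> (\<mu> t)") auto
  qed
  define p where "p t = real_of_ereal (\<psi> (\<mu> t))" for t
  have p: "\<psi> (\<mu> t) = ereal (p t)" for t
    unfolding p_def using psi_fin[of t] by (simp add: ereal_real)
  have f_mu: "?f (\<mu> t) = ereal (p t + v t \<bullet> \<mu> t)" for t
    by (simp add: els_objective_def p sig)
  have U_fin: "\<bar>?U t\<bar> \<noteq> \<infinity>" for t
    by (induction t) (auto simp: f_mu min_def)
  define hb where "hb t = real_of_ereal (?U t)" for t
  have hb: "?U t = ereal (hb t)" for t
    unfolding hb_def using U_fin[of t] by (simp add: ereal_real)
  have hb_le: "hb t \<le> p t + v t \<bullet> \<mu> t" for t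
  proof -
    have "?U t \<le> ?f (\<mu> t)" by (cases t) auto
    then show ?thesis by (simp add: hb f_mu)
  qed
  have "decseq hb"
  proof (rule decseq_SucI)
    fix t
    have "?U (Suc t) \<le> ?U t" by simp
    then show "hb (Suc t) \<le> hb t" by (simp add: hb del: els_upper.simps)
  qed
  have L_le_U: "?L t \<le> ?U s" for t s
  proof -
    have "?L t \<le> ?f (\<mu> r)" for r
      unfolding els_lower_def by (rule INF_lower2[of "\<mu> r"]) (simp_all add: m_le_f)
    then show ?thesis by (induction s) auto
  qed
  have L_MInf: "?L t \<noteq> -\<infinity>" for t
  proof
    \<comment> \<open>Otherwise the level is \<open>-\<infinity>\<close> and the level set, which contains the next iterate, is empty.\<close>
    assume "?L t = -\<infinity>"
    then have "?m t (\<mu> (Suc t)) \<le> -\<infinity>"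
      using muQ[of t] q by (simp add: els_level_set_def els_sublevel_def els_level_def hb q_def)
    then show False
      using m_lower[of "\<mu> (Suc t)" t] by (simp add: p)
  qed
  define hl where "hl t = real_of_ereal (?L t)" for t
  have hl: "?L t = ereal (hl t)" for t
    using L_MInf[of t] L_le_U[of t t] unfolding hl_def hb by (cases "?L t") auto
  have "incseq hl"
  proof (rule incseq_SucI)
    fix t
    have "?L t \<le> ?L (Suc t)"
      unfolding els_lower_def by (rule INF_superset_mono) (simp_all add: m_mono del: els_model.simps)
    then show "hl t \<le> hl (Suc t)" by (simp add: hl)
  qed
  define \<Delta> where "\<Delta> t = hb t - hl t" for t
  have gap: "els_gap \<psi> E Em \<mu> v t = ereal (\<Delta> t)" for t
    by (simp add: els_gap_def hb hl \<Delta>_def)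
  have level: "?l t = ereal (hb t - q * \<Delta> t)" for t
    by (simp add: els_level_def hb hl \<Delta>_def q_def algebra_simps)
  have \<Delta>_nonneg: "0 \<le> \<Delta> t" for t
    using L_le_U[of t t] by (simp add: hb hl \<Delta>_def)
  have \<Delta>_mono: "\<Delta> t \<le> \<Delta> s" if "s \<le> t" for s t
    using decseqD[OF \<open>decseq hb\<close> that] incseqD[OF \<open>incseq hl\<close> that] by (simp add: \<Delta>_def)
  have Q_iff: "x \<in> ?Q t \<longleftrightarrow> ?m t x \<le> ereal (hb t - q * \<Delta> t)" for x t
    by (simp add: els_level_set_def els_sublevel_def level)

  \<comment> \<open>Confinement to the initial sublevel set and uniform constants\<close>
  have Q_sub: "?Q t \<subseteq> ?S" for t
  proof
    fix x assume "x \<in> ?Q t"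
    then have "els_objective \<psi> Em x \<le> ereal (hb t - q * \<Delta> t)"
      using order_trans[OF m0_le] by (simp add: Q_iff)
    also have "\<dots> \<le> ?U 0"
      using decseqD[OF \<open>decseq hb\<close>, of 0 t] \<Delta>_nonneg[of t] q
      by (simp add: hb del: els_upper.simps) (smt (verit) mult_nonneg_nonneg)
    finally show "x \<in> ?S" by (simp add: els_sublevel_def)
  qed
  have mu_S: "\<mu> t \<in> ?S" for t
  proof (cases t)
    case 0
    then show ?thesis
      using els_objective_mono_set[OF EmE, of \<psi> "\<mu> 0"] by (simp add: els_sublevel_def)
  next
    case (Suc s)
    then show ?thesis using muQ[of s] Q_sub[of s] by auto
  qed

  define X where "X x = real_of_ereal (\<Xi> x)" for x
  have X: "\<Xi> x = ereal (X x)" if "x \<in> ?S" for x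
    using that A4(1) unfolding X_def effective_domain_def by (auto simp: ereal_real)
  obtain M where M: "\<bar>X x\<bar> \<le> M" if "x \<in> ?S" for x
    using A4(2) X by force
  have "bounded ?S"
    using coercive_sublevel_bounded[OF A3(2), of "hb 0"]
    by (simp add: els_sublevel_def hb del: els_upper.simps)
  then obtain R where R: "norm x \<le> R" if "x \<in> ?S" for x
    unfolding bounded_iff by blast
  obtain Cw where Cw: "norm (w t) \<le> Cw" for t using A5(2) by blast
  obtain Cv where Cv: "norm (v t) \<le> Cv" for t using A2(2) by blast
  obtain Cp where "Cp > 0" and
    Cp: "\<bar>\<psi> (\<mu> (Suc t)) - \<psi> (\<mu> t)\<bar> \<le> ereal (Cp * norm (\<mu> (Suc t) - \<mu> t))" for t
    using A6 by blast
  have "0 \<le> Cv" by (rule order_trans[OF norm_ge_zero Cv])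

  \<comment> \<open>Lower bound on the step length\<close>
  define G where "G = Cp + Cv"
  have "G > 0" using \<open>Cp > 0\<close> \<open>0 \<le> Cv\<close> by (simp add: G_def)
  have step: "q * \<Delta> t \<le> G * norm (\<mu> (Suc t) - \<mu> t)" for t
  proof -
    have "ereal (p (Suc t) + v t \<bullet> \<mu> (Suc t)) \<le> ereal (hb t - q * \<Delta> t)"
      using order_trans[OF m_lower muQ[of t, unfolded Q_iff]] by (simp add: p)
    \<comment> \<open>The cut \<open>v t\<close> is exact at \<open>\<mu> t\<close>, so
      \<open>\<psi>\<close> plus the cut is at least \<open>hb t\<close> there, while at the next
      iterate it is below the level.\<close>
    then have "q * \<Delta> t \<le> (p t - p (Suc t)) + v t \<bullet> (\<mu> t - \<mu> (Suc t))"
      using hb_le[of t] by (simp add: inner_diff_right)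
    moreover have "p t - p (Suc t) \<le> Cp * norm (\<mu> (Suc t) - \<mu> t)"
      using Cp[of t] by (simp add: p)
    moreover have "v t \<bullet> (\<mu> t - \<mu> (Suc t)) \<le> Cv * norm (\<mu> (Suc t) - \<mu> t)"
      using order_trans[OF norm_cauchy_schwarz mult_right_mono[OF Cv[of t] norm_ge_zero]]
      by (metis norm_minus_commute)
    ultimately show ?thesis by (simp add: G_def algebra_simps)
  qed

  \<comment> \<open>Bregman distances along the iterates\<close>
  define B where "B x t = X x - X (\<mu> t) - w t \<bullet> (x - \<mu> t)" for x t
  have B_lower: "\<beta> / 2 * (norm (x - \<mu> t))\<^sup>2 \<le> B x t" if "x \<in> ?S" for x t
    unfolding B_def
    by (rule strongly_convex_subgradient[OF Xi(2) w X[OF that] X[OF mu_S]])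
  \<comment> \<open>Two values of \<open>X\<close> contribute at most \<open>M\<close> each;
    Cauchy-Schwarz with points at distance at most \<open>2 * R\<close> bounds the linear
    term.\<close>
  define D where "D = 2 * M + Cw * (2 * R)"
  have B_upper: "B x t \<le> D" if x: "x \<in> ?S" for x t
  proof -
    have "- (w t \<bullet> (x - \<mu> t)) \<le> norm (w t) * norm (x - \<mu> t)"
      using Cauchy_Schwarz_ineq2[of "w t" "x - \<mu> t"] by linarith
    also have "\<dots> \<le> Cw * (2 * R)"
      using R[OF x] R[OF mu_S[of t]] norm_triangle_ineq4[of x "\<mu> t"] Cw[of t]
      by (intro mult_mono order_trans[OF norm_ge_zero Cw]) auto
    finally show ?thesis
      using M[OF x] M[OF mu_S[of t]] by (simp add: B_def D_def)
  qed
  have B_step: "B x (Suc t) + \<beta> / 2 * (norm (\<mu> (Suc t) - \<mu> t))\<^sup>2 \<le> B x t" if x: "x \<in> ?Q t" for x t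
  proof -
    \<comment> \<open>Three-point identity: the normal cone condition makes the right-hand side
      nonpositive, and strong convexity bounds the middle Bregman term from below.\<close>
    have "B x (Suc t) + B (\<mu> (Suc t)) t - B x t = (w t - w (Suc t)) \<bullet> (x - \<mu> (Suc t))"
      unfolding B_def by (simp add: algebra_simps inner_diff_left inner_diff_right)
    then show ?thesis
      using wN[OF x] B_lower[OF mu_S, of "Suc t" t] by linarith
  qed

  \<comment> \<open>Estimate on a block of comparable gaps\<close>
  define K where "K = D * (2 * G\<^sup>2 / (\<beta> * q\<^sup>2))"
  have "0 \<le> D"
    using order_trans[OF B_lower B_upper, OF mu_S mu_S, of 0 0] by simp
  then have "0 \<le> K" using beta by (simp add: K_def)
  have block: "real (Suc T - s) * (\<Delta> T)\<^sup>2 \<le> K" if sT: "s \<le> T" and near: "q * \<Delta> s < \<Delta> T" for s T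
  proof -
    \<comment> \<open>Here \<open>hl T = hb T - \<Delta> T\<close>. The strict inequality provides a
      point below this level even if the infimum is not attained.\<close>
    have "?L T < ereal (hb T - q * \<Delta> s)" using near by (simp add: hl \<Delta>_def)
    then obtain x where x: "?m T x < ereal (hb T - q * \<Delta> s)"
      unfolding els_lower_def by (auto simp: INF_less_iff)
    \<comment> \<open>One point serves the whole block: going back from \<open>T\<close> to
      \<open>t\<close> lowers the model and raises \<open>hb\<close>, and
      \<open>\<Delta> t \<le> \<Delta> s\<close>.\<close>
    have xQ: "x \<in> ?Q t" if "s \<le> t" "t \<le> T" for t
    proof -
      have "?m t x \<le> ereal (hb T - q * \<Delta> s)"
        using order_trans[OF m_mono[OF that(2)] less_imp_le[OF x]] .
      also have "\<dots> \<le> ereal (hb t - q * \<Delta> t)"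
        using decseqD[OF \<open>decseq hb\<close> that(2)] \<Delta>_mono[OF that(1)] q by (simp add: diff_mono)
      finally show ?thesis by (simp add: Q_iff)
    qed
    \<comment> \<open>Guaranteed drop per step, uniform over the block because
      \<open>\<Delta> T \<le> \<Delta> t\<close>. The second factor of \<open>K\<close> turns
      \<open>c\<close> into the square of \<open>\<Delta> T\<close>.\<close>
    define c where "c = \<beta> / 2 * (q * \<Delta> T / G)\<^sup>2"
    have dec: "B x (Suc t) + c \<le> B x t" if "s \<le> t" "t \<le> T" for t
    proof -
      have "q * \<Delta> T \<le> norm (\<mu> (Suc t) - \<mu> t) * G"
        using order_trans[OF mult_left_mono[OF \<Delta>_mono[OF that(2)]] step[of t]] q
        by (simp add: mult.commute)
      then have "q * \<Delta> T / G \<le> norm (\<mu> (Suc t) - \<mu> t)"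
        using \<open>G > 0\<close> by (simp add: pos_divide_le_eq)
      then have "(q * \<Delta> T / G)\<^sup>2 \<le> (norm (\<mu> (Suc t) - \<mu> t))\<^sup>2"
        using q \<Delta>_nonneg \<open>G > 0\<close> by (intro power_mono) auto
      then have "c \<le> \<beta> / 2 * (norm (\<mu> (Suc t) - \<mu> t))\<^sup>2"
        unfolding c_def using beta by (intro mult_left_mono) auto
      then show ?thesis using B_step[OF xQ[OF that]] by linarith
    qed
    \<comment> \<open>The range extends to \<open>Suc T\<close> because the step leaving
      \<open>\<mu> T\<close> also counts, giving \<open>Suc T - s\<close> drops.\<close>
    have "B x (s + n) + real n * c \<le> B x s" if "s + n \<le> Suc T" for n
      using that
    proof (induction n)
      case (Suc n)
      then show ?case using dec[of "s + n"] by (simp add: algebra_simps)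
    qed simp
    from this[of "Suc T - s"] have "B x (Suc T) + real (Suc T - s) * c \<le> B x s" using sT by simp
    moreover have xS: "x \<in> ?S" using xQ[OF sT] Q_sub by blast
    moreover have "0 \<le> B x (Suc T)" using order_trans[OF _ B_lower[OF xS]] beta by simp
    ultimately have "real (Suc T - s) * c \<le> D" using B_upper[of x s] by linarith
    then have "real (Suc T - s) * (c * (2 * G\<^sup>2 / (\<beta> * q\<^sup>2))) \<le> K"
      unfolding K_def mult.assoc[symmetric] using beta by (intro mult_right_mono) auto
    moreover have "c * (2 * G\<^sup>2 / (\<beta> * q\<^sup>2)) = (\<Delta> T)\<^sup>2"
      using beta q \<open>G > 0\<close> by (simp add: c_def power_divide power_mult_distrib)
    ultimately show ?thesis by (simp only:)
  qed

  \<comment> \<open>Rate and convergence of the gap\<close>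
  define A where "A = K / (1 - q\<^sup>2) + 1"
  \<comment> \<open>The summand 1 in \<open>A\<close> keeps the final constant \<open>sqrt A\<close>
    positive even when \<open>K = 0\<close>.\<close>
  have "A > 0" using \<open>0 \<le> K\<close> q by (simp add: A_def power_le_one add_nonneg_pos)
  have rate: "\<Delta> t \<le> sqrt A / sqrt (real t)" if "t \<ge> 1" for t
  proof -
    have "real t * (\<Delta> t)\<^sup>2 \<le> real (Suc t) * (\<Delta> t)\<^sup>2"
      by (intro mult_right_mono) auto
    also have "\<dots> \<le> A"
      using gap_square_bound[OF q \<Delta>_nonneg \<open>0 \<le> K\<close> block, of t] unfolding A_def by linarith
    finally have "(\<Delta> t)\<^sup>2 \<le> A / real t" using that by (simp add: field_simps)
    then have "\<Delta> t \<le> sqrt (A / real t)" by (rule real_le_rsqrt)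
    then show ?thesis by (simp add: real_sqrt_divide)
  qed
  have "(\<lambda>t. sqrt A * inverse (sqrt (real t))) \<longlonglongrightarrow> sqrt A * 0"
    by (intro tendsto_intros tendsto_inverse_0_at_top
        filterlim_compose[OF sqrt_at_top filterlim_real_sequentially])
  then have lim: "(\<lambda>t. sqrt A / sqrt (real t)) \<longlonglongrightarrow> 0" by (simp add: divide_inverse)
  have "\<Delta> \<longlonglongrightarrow> 0"
    by (rule tendsto_sandwich[OF _ _ tendsto_const lim])
      (auto intro: \<Delta>_nonneg rate eventually_sequentiallyI[of 1])
  then have "els_gap \<psi> E Em \<mu> v \<longlonglongrightarrow> 0"
    using ext[of "els_gap \<psi> E Em \<mu> v", OF gap] by (simp add: zero_ereal_def)
  moreover have "\<exists>C>0. \<forall>t\<ge>1. els_gap \<psi> E Em \<mu> v t \<le> ereal (C / sqrt (real t))"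
    using \<open>A > 0\<close> rate by (intro exI[of _ "sqrt A"]) (simp add: gap)
  ultimately show ?thesis by blast
qed

end
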